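(* Let $(P_1(x,n))_{n\ge 0}$ and $(P_2(x,n))_{n\ge 0}$ be two sequences of polynomials in $x$ such that $P_k(x,n)$ has degree exactly $n$ for all $n\ge 0$ and $k\in\{1,2\}$. Let $k,h\in\{1,2\}$ with $k\ne h$, and let $n\ge 0$ be an integer. Put $B_{h,n}=\sum_{m=0}^n D_{h,n}^m$. Then $$B_{h,n}=\sum_{j=0}^n\left[\sum_{m=0}^nL_{k,h,j}^m\right]D_{k,n}^j,$$ where $D_{k,n}^j$ are the generalized Stirling numbers of the second kind and $L_{k,h,j}^m$ the generalized Lah numbers associated with the two polynomial sequences.
   Context: For $k\in\{1,2\}$, the generalized Stirling numbers of the second kind $D_{k,n}^j$ ($0\le j\le n$) are the coefficients in the polynomial identity $x^n=\sum_{j=0}^nD_{k,n}^jP_k(x,j)$. For $k\neq h$ in $\{1,2\}$, the generalized Lah numbers $L_{k,h,n}^j$ ($0\le j\le n$) are the coefficients in the polynomial identity $P_k(x,n)=\sum_{j=0}^nL_{k,h,n}^jP_h(x,j)$. By convention $L_{k,h,n}^j=0$ for $j>n$. Polynomials have coefficients in a field of characteristic zero (e.g. the real or complex numbers). *)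

theory Defs
  imports Complex_Main "HOL-Computational_Algebra.Polynomial"
begin

text \<open>The conjunct \<open>p n \<noteq> 0\<close> matters for \<open>n = 0\<close>, as the library sets \<open>degree 0 = 0\<close>.\<close>
definition graded_poly_seq :: "(nat \<Rightarrow> 'a::field_char_0 poly) \<Rightarrow> bool" where
  "graded_poly_seq p \<longleftrightarrow> (\<forall>n. p n \<noteq> 0 \<and> degree (p n) = n)"

text \<open>For a sequence \<open>p\<close> with \<open>degree (p n) = n\<close> the coefficients below exist and are unique; the
  value at indices \<open>j > n\<close>, where the expansion has no term, is 0.\<close>
definition gen_stirling2 :: "(nat \<Rightarrow> 'a::field_char_0 poly) \<Rightarrow> nat \<Rightarrow> nat \<Rightarrow> 'a" where
  "gen_stirling2 p n =
     (THE c. (\<forall>j>n. c j = 0) \<and> monom 1 n = (\<Sum>j=0..n. smult (c j) (p j)))"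

definition gen_lah ::
    "(nat \<Rightarrow> 'a::field_char_0 poly) \<Rightarrow> (nat \<Rightarrow> 'a poly) \<Rightarrow> nat \<Rightarrow> nat \<Rightarrow> 'a" where
  "gen_lah p q n =
     (THE c. (\<forall>j>n. c j = 0) \<and> p n = (\<Sum>j=0..n. smult (c j) (q j)))"

definition gen_bell :: "(nat \<Rightarrow> 'a::field_char_0 poly) \<Rightarrow> nat \<Rightarrow> 'a" where
  "gen_bell p n = (\<Sum>m=0..n. gen_stirling2 p n m)"

end

(* Substituting the expansion of each p j in the q m into the expansion of x^n in the p j and
   comparing coefficients (the q m are linearly independent) gives D_q = L_{p,q} D_p; summing
   over the rows yields the Bell number identity. *)
theory Submission imports Defs begin

text \<open>Induction on the degree bound: a suitable multiple of \<open>p (Suc n)\<close> removes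
  the coefficient of degree \<open>Suc n\<close>, and the remainder falls under the induction
  hypothesis.\<close>

lemma graded_expansion_exists:
  fixes f :: "'a::field_char_0 poly"
  assumes p: "graded_poly_seq p" and "degree f \<le> n"
  shows "\<exists>c. (\<forall>j>n. c j = 0) \<and> f = (\<Sum>j=0..n. smult (c j) (p j))"
  using assms(2)
proof (induction n arbitrary: f)
  case 0
  have p0: "p 0 \<noteq> 0" "degree (p 0) = 0"
    using p by (auto simp: graded_poly_seq_def)
  obtain a b where ab: "f = [:a:]" "p 0 = [:b:]"
    using 0 p0(2) by (metis degree_eq_zeroE le_zero_eq)
  then have "f = smult (a / b) (p 0)"
    using p0(1) by simp
  then show ?case
    by (intro exI[of _ "\<lambda>j. if j = 0 then a / b else 0"]) auto
next
  case (Suc n)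
  have ps: "p (Suc n) \<noteq> 0" "degree (p (Suc n)) = Suc n"
    using p by (auto simp: graded_poly_seq_def)
  then have lc: "coeff (p (Suc n)) (Suc n) \<noteq> 0"
    by (metis leading_coeff_0_iff)
  \<comment> \<open>Chosen so that the coefficients of degree \<open>Suc n\<close> cancel in
    \<open>g\<close>; in higher degrees both \<open>f\<close> and \<open>p (Suc n)\<close> have
    coefficient 0.\<close>
  define a where "a = coeff f (Suc n) / coeff (p (Suc n)) (Suc n)"
  define g where "g = f - smult a (p (Suc n))"
  have "degree g \<le> n"
  proof (rule degree_le, intro allI impI)
    fix i assume "n < i"
    then consider "i = Suc n" | "i > Suc n" by linarith
    then show "coeff g i = 0"
      by cases (use lc Suc.prems ps(2) in \<open>auto simp: g_def a_def coeff_eq_0\<close>)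
  qed
  then obtain c where c: "\<forall>j>n. c j = 0" "g = (\<Sum>j=0..n. smult (c j) (p j))"
    using Suc.IH by blast
  \<comment> \<open>Since \<open>c\<close> vanishes beyond \<open>n\<close>, the update only
    replaces a zero.\<close>
  have "f = (\<Sum>j=0..Suc n. smult ((c(Suc n := a)) j) (p j))"
    using c(2) by (simp add: g_def algebra_simps)
  then show ?case
    using c(1) by (intro exI[of _ "c(Suc n := a)"]) auto
qed

text \<open>Linear independence, peeled off from the top: only \<open>p (Suc n)\<close> contributes
  in degree \<open>Suc n\<close>, so its coefficient \<open>c (Suc n)\<close> must be 0, and the sum
  shortens.\<close>

lemma graded_expansion_zero:
  fixes p :: "nat \<Rightarrow> 'a::field_char_0 poly"
  assumes p: "graded_poly_seq p" and "(\<Sum>j=0..n. smult (c j) (p j)) = 0" and "j \<le> n"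
  shows "c j = 0"
  using assms(2,3)
proof (induction n)
  case 0
  then show ?case
    using p by (auto simp: graded_poly_seq_def)
next
  case (Suc n)
  have ps: "p (Suc n) \<noteq> 0" "degree (p i) = i" for i
    using p by (auto simp: graded_poly_seq_def)
  have "coeff (\<Sum>j=0..Suc n. smult (c j) (p j)) (Suc n) = c (Suc n) * coeff (p (Suc n)) (Suc n)"
    by (simp add: coeff_sum coeff_eq_0 ps)
  then have "c (Suc n) = 0"
    using Suc.prems(1) ps by (metis coeff_0 leading_coeff_0_iff mult_eq_0_iff)
  then show ?case
    using Suc by (cases "j = Suc n") auto
qed

text \<open>Justifies the definite descriptions in \<open>gen_stirling2\<close> and
  \<open>gen_lah\<close>. Fixing \<open>c\<close> to 0 beyond \<open>n\<close> is what makes it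
  unique as a function on all of \<open>nat\<close>.\<close>

lemma graded_expansion_ex1:
  fixes f :: "'a::field_char_0 poly"
  assumes p: "graded_poly_seq p" and "degree f \<le> n"
  shows "\<exists>!c. (\<forall>j>n. c j = 0) \<and> f = (\<Sum>j=0..n. smult (c j) (p j))"
proof (rule ex_ex1I)
  show "\<exists>c. (\<forall>j>n. c j = 0) \<and> f = (\<Sum>j=0..n. smult (c j) (p j))"
    using graded_expansion_exists[OF assms] .
next
  fix c d
  assume c: "(\<forall>j>n. c j = 0) \<and> f = (\<Sum>j=0..n. smult (c j) (p j))"
    and d: "(\<forall>j>n. d j = 0) \<and> f = (\<Sum>j=0..n. smult (d j) (p j))"
  then have "(\<Sum>j=0..n. smult (c j - d j) (p j)) = 0"
    by (simp add: smult_diff_left sum_subtractf)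
  then have "c j = d j" if "j \<le> n" for j
    using graded_expansion_zero[OF p, of "\<lambda>j. c j - d j" n j] that by simp
  then show "c = d"
    using c d by (metis ext not_le)
qed

lemma gen_stirling2_unique:
  assumes "graded_poly_seq p" and "\<forall>j>n. c j = 0"
    and "monom 1 n = (\<Sum>j=0..n. smult (c j) (p j))"
  shows "gen_stirling2 p n = c"
  unfolding gen_stirling2_def
  using graded_expansion_ex1[OF assms(1) degree_monom_le[of 1 n]] assms(2,3)
  by (intro the1_equality) blast+

lemma gen_stirling2_expansion:
  assumes "graded_poly_seq p"
  shows "monom 1 n = (\<Sum>j=0..n. smult (gen_stirling2 p n j) (p j))"
  using theI'[OF graded_expansion_ex1[OF assms degree_monom_le[of 1 n]]]
  unfolding gen_stirling2_def by blast

lemma gen_lah_expansion: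
  assumes "graded_poly_seq p" and "graded_poly_seq q"
  shows "\<forall>j>n. gen_lah p q n j = 0"
    and "p n = (\<Sum>j=0..n. smult (gen_lah p q n j) (q j))"
proof -
  have "degree (p n) \<le> n"
    using assms(1) by (simp add: graded_poly_seq_def)
  from theI'[OF graded_expansion_ex1[OF assms(2) this]]
  show "\<forall>j>n. gen_lah p q n j = 0"
    and "p n = (\<Sum>j=0..n. smult (gen_lah p q n j) (q j))"
    unfolding gen_lah_def by blast+
qed

lemma gen_stirling2_eq_sum_gen_lah:
  fixes p q :: "nat \<Rightarrow> 'a::field_char_0 poly"
  assumes p: "graded_poly_seq p" and q: "graded_poly_seq q"
  shows "gen_stirling2 q n m = (\<Sum>j=0..n. gen_lah p q j m * gen_stirling2 p n j)"
proof -
  let ?c = "\<lambda>m. \<Sum>j=0..n. gen_lah p q j m * gen_stirling2 p n j"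
  \<comment> \<open>The expansion of \<open>p j\<close> is padded with zero terms from
    \<open>j\<close> up to \<open>n\<close>, so that the inner range no longer depends on
    \<open>j\<close> and the sums can be swapped.\<close>
  have lah: "p j = (\<Sum>m=0..n. smult (gen_lah p q j m) (q m))" if "j \<le> n" for j
    using gen_lah_expansion[OF p q, of j] that
    by (auto intro: trans[OF _ sum.mono_neutral_left])
  have "monom 1 n = (\<Sum>j=0..n. smult (gen_stirling2 p n j) (p j))"
    by (rule gen_stirling2_expansion[OF p])
  also have "\<dots> = (\<Sum>j=0..n. \<Sum>m=0..n. smult (gen_lah p q j m * gen_stirling2 p n j) (q m))"
    by (intro sum.cong refl, subst lah)
      (auto intro!: poly_eqI simp: coeff_sum sum_distrib_left mult_ac)
  also have "\<dots> = (\<Sum>m=0..n. smult (?c m) (q m))"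
    by (subst sum.swap) (simp add: smult_sum)
  finally have "monom 1 n = (\<Sum>m=0..n. smult (?c m) (q m))" .
  \<comment> \<open>Every \<open>j\<close> in the sum satisfies \<open>j \<le> n < m\<close>, so
    each Lah number is 0. Uniqueness then gives the identity for all \<open>m\<close>, also beyond
    \<open>n\<close>.\<close>
  moreover have "\<forall>m>n. ?c m = 0"
    using gen_lah_expansion(1)[OF p q] by (auto intro!: sum.neutral)
  ultimately show ?thesis
    using gen_stirling2_unique[OF q, of n ?c] by simp
qed

theorem mainTheorem4:
  fixes P :: "nat \<Rightarrow> nat \<Rightarrow> 'a::field_char_0 poly" and k h n :: nat
  assumes "\<And>i. i \<in> {1, 2} \<Longrightarrow> graded_poly_seq (P i)"
    and "k \<in> {1, 2}" and "h \<in> {1, 2}" and "k \<noteq> h"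
  shows "gen_bell (P h) n =
    (\<Sum>j=0..n. (\<Sum>m=0..n. gen_lah (P k) (P h) j m) * gen_stirling2 (P k) n j)"
proof -
  have "gen_bell (P h) n =
      (\<Sum>m=0..n. \<Sum>j=0..n. gen_lah (P k) (P h) j m * gen_stirling2 (P k) n j)"
    using gen_stirling2_eq_sum_gen_lah[OF assms(1)[OF assms(2)] assms(1)[OF assms(3)]]
    by (simp add: gen_bell_def)
  \<comment> \<open>After the swap \<open>m\<close> is the inner index, and the Stirling factor,
    independent of \<open>m\<close>, can be pulled out.\<close>
  then show ?thesis
    by (subst (asm) sum.swap) (simp add: sum_distrib_right)
qed

end
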